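(* Let $G$ be a finite simple graph whose Seidel matrix has all but at most two eigenvalues (counted with multiplicity) in the interval $[-1,1]$. Then $G$ is switching equivalent to a graph in $\mathcal{F}$, where $\mathcal{F}$ is the class of graphs $H$ such that $H$ or its complement is isomorphic to $K_m+\ell K_1$ (a clique on $m$ vertices plus $\ell$ isolated vertices) for some $m\geq1$, $\ell\geq 0$.
   Context: The Seidel matrix of a graph $G$ with adjacency matrix $A_G$ is $S=J-I-2A_G$ (entries $-1$ for adjacent pairs, $+1$ for nonadjacent distinct pairs, $0$ on the diagonal); $J$ is the all-ones matrix. Switching $G$ with respect to a vertex subset $X$ replaces, for every pair $u\in X$, $v\notin X$, adjacency by nonadjacency and vice versa (equivalently, multiplies the rows and columns of $S$ indexed by $X$ by $-1$). Two graphs are switching equivalent if one can be switched into a graph isomorphic to the other. *)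

theory Defs
  imports
    "Jordan_Normal_Form.Char_Poly"
    "Graph_Theory.Pair_Digraph"
    "Graph_Theory.Digraph_Isomorphism"
begin

text \<open>
  Finite simple graphs are the finite symmetric loop-free digraphs without parallel arcs,
  i.e. the instances of \<^locale>\<open>pair_graph\<close>: an edge \<open>uv\<close> is the pair of arcs
  \<open>(u, v)\<close>, \<open>(v, u)\<close>.
\<close>

definition graph_complement :: "'a pair_pre_digraph \<Rightarrow> 'a pair_pre_digraph" where
  "graph_complement G =
     \<lparr> pverts = pverts G,
       parcs = {(u, v) \<in> pverts G \<times> pverts G. u \<noteq> v \<and> (u, v) \<notin> parcs G} \<rparr>"

definition switch :: "'a pair_pre_digraph \<Rightarrow> 'a set \<Rightarrow> 'a pair_pre_digraph" where
  "switch G X =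
     \<lparr> pverts = pverts G,
       parcs = {(u, v) \<in> pverts G \<times> pverts G.
                  if (u \<in> X) = (v \<in> X) then (u, v) \<in> parcs G else (u, v) \<notin> parcs G} \<rparr>"

definition switching_equivalent :: "'a pair_pre_digraph \<Rightarrow> 'b pair_pre_digraph \<Rightarrow> bool" where
  "switching_equivalent G H \<longleftrightarrow>
     (\<exists>X \<subseteq> pverts G. digraph_iso (with_proj (switch G X)) (with_proj H))"

text \<open>\<open>K\<^sub>m + l K\<^sub>1\<close>: the clique is on \<open>{..<m}\<close>, the isolated vertices are \<open>m, \<dots>, m + l - 1\<close>.\<close>

definition clique_plus_isolated :: "nat \<Rightarrow> nat \<Rightarrow> nat pair_pre_digraph" where
  "clique_plus_isolated m l =
     \<lparr> pverts = {..<m + l}, parcs = {(u, v). u < m \<and> v < m \<and> u \<noteq> v} \<rparr>"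

definition family_F :: "'a pair_pre_digraph set" where
  "family_F = {H. pair_graph H \<and>
     (\<exists>m l. m \<ge> 1 \<and>
        (digraph_iso (with_proj H) (with_proj (clique_plus_isolated m l)) \<or>
         digraph_iso (with_proj (graph_complement H)) (with_proj (clique_plus_isolated m l))))}"

text \<open>
  Matrices of a graph are taken with respect to a list \<open>vs\<close> enumerating its vertices without
  repetition: row and column \<open>i\<close> belong to the vertex \<open>vs ! i\<close>.
\<close>

definition adjacency_matrix :: "'a pair_pre_digraph \<Rightarrow> 'a list \<Rightarrow> real mat" where
  "adjacency_matrix G vs =
     mat (length vs) (length vs) (\<lambda>(i, j). if (vs ! i, vs ! j) \<in> parcs G then 1 else 0)"

definition all_ones_matrix :: "nat \<Rightarrow> real mat" where
  "all_ones_matrix n = mat n n (\<lambda>_. 1)"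

definition seidel_matrix :: "'a pair_pre_digraph \<Rightarrow> 'a list \<Rightarrow> real mat" where
  "seidel_matrix G vs =
     all_ones_matrix (length vs) - 1\<^sub>m (length vs) - 2 \<cdot>\<^sub>m adjacency_matrix G vs"

text \<open>
  Eigenvalues with algebraic multiplicity. A Seidel matrix is real symmetric, so its
  characteristic polynomial splits over the reals and no eigenvalue is lost by taking real roots.
\<close>

definition eigenvalues_mset :: "real mat \<Rightarrow> real multiset" where
  "eigenvalues_mset A = proots (char_poly A)"

lemma seidel_matrix_index:
  assumes "pair_graph G" and "distinct vs" and "i < length vs" and "j < length vs"
  shows "seidel_matrix G vs $$ (i, j) =
    (if i = j then 0 else if (vs ! i, vs ! j) \<in> parcs G then -1 else 1)"
proof -
  interpret pair_graph G by fact
  have "(v, v) \<notin> parcs G" for v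
    using pair_no_loops[of "(v, v)"] by auto
  then show ?thesis
    using assms(2-4)
    by (auto simp: seidel_matrix_def adjacency_matrix_def all_ones_matrix_def)
qed

end

theory Submission
  imports Defs "Jordan_Normal_Form.Schur_Decomposition"
begin

text \<open>
  Suppose that \<open>J \<subseteq> T\<close> are sets of three and five vertices such that the columns of the Seidel
  matrix \<open>S\<close> indexed by \<open>J\<close> and restricted to the rows in \<open>T\<close> have pairwise inner products at most
  1 in absolute value. These columns have squared length 4, so their Gram matrix exceeds the identity
  by diagonal dominance, and \<open>S\<close> strictly expands every nonzero vector supported on \<open>J\<close>. By the
  spectral theorem, \<open>S\<close> does not expand on a subspace whose codimension is the number of eigenvalues
  outside \<open>[-1, 1]\<close>; if there are at most two of these, the subspace contains a nonzero vector
  supported on \<open>J\<close>. Hence no such \<open>J\<close> and \<open>T\<close> exist. This property is invariant under switching.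
  After switching so that a vertex \<open>v\<close> becomes isolated, it says that the rest of the graph has no
  induced \<open>C\<^sub>4\<close>, \<open>2K\<^sub>2\<close>, \<open>P\<^sub>4\<close>, \<open>P\<^sub>3 + K\<^sub>1\<close> or paw. Such a graph cannot contain both an induced
  \<open>P\<^sub>3\<close> and an induced complement of \<open>P\<^sub>3\<close>, so it is \<open>K\<^sub>m + lK\<^sub>1\<close> or the complement of such a
  graph; in the second case \<open>v\<close> is switched once more to become dominating.
\<close>

section \<open>The spectral theorem\<close>

lemma hermitian_mat_eigenvalue_real:
  fixes A :: "complex mat"
  assumes A: "A \<in> carrier_mat n n" and hermitian: "map_mat cnj A = A\<^sup>T" and "eigenvalue A z"
  shows "z \<in> \<real>"
proof -
  obtain v where v: "v \<in> carrier_vec n" "v \<noteq> 0\<^sub>v n" and eigen: "A *\<^sub>v v = z \<cdot>\<^sub>v v"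
    using assms(3) A by (auto simp: eigenvalue_def eigenvector_def)
  have conj: "map_mat cnj A *\<^sub>v conjugate v = conjugate (A *\<^sub>v v)"
    using A v by (intro eq_vecI) (auto simp: scalar_prod_def)
  have "z * (v \<bullet>c v) = (A *\<^sub>v v) \<bullet>c v"
    using v eigen by simp
  also have "\<dots> = v \<bullet> (A\<^sup>T *\<^sub>v conjugate v)"
    using transpose_vec_mult_scalar[of "A\<^sup>T" n n "conjugate v" v] A v by simp
  also have "\<dots> = cnj z * (v \<bullet>c v)"
    using v by (simp flip: hermitian add: conj eigen conjugate_smult_vec)
  finally have "z = cnj z"
    using v conjugate_square_eq_0_vec[OF v(1)] by simp
  then show ?thesis
    by (metis Reals_cnj_iff)
qed

lemma symmetric_mat_has_eigenvalue:
  fixes A :: "real mat"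
  assumes A: "A \<in> carrier_mat n n" and sym: "A\<^sup>T = A" and "n > 0"
  shows "\<exists>e. eigenvalue A e"
proof -
  let ?B = "map_mat complex_of_real A"
  have B: "?B \<in> carrier_mat n n"
    using A by simp
  obtain as where "char_poly ?B = (\<Prod>a\<leftarrow>as. [:- a, 1:])" "length as = n"
    using char_poly_factorized[OF B] by blast
  then obtain z where z: "poly (char_poly ?B) z = 0"
    using \<open>n > 0\<close> by (cases as) auto
  moreover have "map_mat cnj ?B = ?B\<^sup>T"
    by (subst sym[symmetric]) auto
  ultimately have "z \<in> \<real>"
    using hermitian_mat_eigenvalue_real[OF B] eigenvalue_root_char_poly[OF B] by blast
  then obtain e where "z = complex_of_real e"
    by (rule Reals_cases)
  with z have "poly (char_poly A) e = 0"
    by (simp add: of_real_hom.char_poly_hom[OF A])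
  then show ?thesis
    using eigenvalue_root_char_poly[OF A] by blast
qed

text \<open>
  The library's \<^const>\<open>orthogonal_mat\<close> asks only for pairwise orthogonal nonzero columns.
\<close>

definition orthonormal_mat :: "nat \<Rightarrow> 'a :: field mat \<Rightarrow> bool" where
  "orthonormal_mat n P \<longleftrightarrow> P \<in> carrier_mat n n \<and> P\<^sup>T * P = 1\<^sub>m n"

lemma orthonormal_matD:
  assumes "orthonormal_mat n P"
  shows "P \<in> carrier_mat n n" and "P\<^sup>T * P = 1\<^sub>m n" and "P * P\<^sup>T = 1\<^sub>m n"
proof -
  show P: "P \<in> carrier_mat n n" and "P\<^sup>T * P = 1\<^sub>m n"
    using assms by (simp_all add: orthonormal_mat_def)
  then show "P * P\<^sup>T = 1\<^sub>m n"
    by (intro mat_mult_left_right_inverse[of "P\<^sup>T" n P]) simp_all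
qed

lemma orthonormal_mat_transpose:
  assumes "orthonormal_mat n P"
  shows "orthonormal_mat n P\<^sup>T"
  using orthonormal_matD[OF assms] by (simp add: orthonormal_mat_def)

lemma mult_block_diagonal_mat:
  assumes "A \<in> carrier_mat m m" "B \<in> carrier_mat n n" "C \<in> carrier_mat m m" "D \<in> carrier_mat n n"
  shows "four_block_mat A (0\<^sub>m m n) (0\<^sub>m n m) B * four_block_mat C (0\<^sub>m m n) (0\<^sub>m n m) D =
    four_block_mat (A * C) (0\<^sub>m m n) (0\<^sub>m n m) (B * D)"
  using assms by (subst mult_four_block_mat[of _ m m _ n _ n _ _ m _ n]) auto

lemma orthonormal_mat_one_block:
  assumes "orthonormal_mat n P"
  shows "orthonormal_mat (Suc n) (four_block_mat (1\<^sub>m 1) (0\<^sub>m 1 n) (0\<^sub>m n 1) P)"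
    (is "orthonormal_mat _ ?U")
proof -
  note P = orthonormal_matD[OF assms]
  have "?U\<^sup>T = four_block_mat (1\<^sub>m 1) (0\<^sub>m 1 n) (0\<^sub>m n 1) P\<^sup>T"
    using P(1) by (simp add: transpose_four_block_mat[of _ 1 1 _ n _ n])
  then have "?U\<^sup>T * ?U = 1\<^sub>m (Suc n)"
    using P(1) mult_block_diagonal_mat[of "1\<^sub>m 1" 1 "P\<^sup>T" n "1\<^sub>m 1" P] by (simp add: P(2))
  then show ?thesis
    using four_block_carrier_mat[of "1\<^sub>m 1" 1 1 P n n] P by (simp add: orthonormal_mat_def)
qed

lemma orthonormal_mat_mult:
  assumes "orthonormal_mat n P" and "orthonormal_mat n Q"
  shows "orthonormal_mat n (P * Q)"
proof -
  note P = orthonormal_matD[OF assms(1)] and Q = orthonormal_matD[OF assms(2)]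
  have "(P * Q)\<^sup>T * (P * Q) = Q\<^sup>T * (P\<^sup>T * P) * Q"
    using P(1) Q(1)
    by (simp add: transpose_mult[of _ n n _ n] mult_carrier_mat[of _ n n _ n]
        assoc_mult_mat[of _ n n _ n _ n])
  also have "\<dots> = 1\<^sub>m n"
    using Q by (simp add: P(2))
  finally show ?thesis
    using P(1) Q(1) by (simp add: orthonormal_mat_def)
qed

lemma orthonormal_mat_scalar_prod:
  assumes "orthonormal_mat n P" and x: "x \<in> carrier_vec n"
  shows "(P *\<^sub>v x) \<bullet> (P *\<^sub>v x) = x \<bullet> x"
proof -
  note P = orthonormal_matD[OF assms(1)]
  have "(P *\<^sub>v x) \<bullet> (P *\<^sub>v x) = (P\<^sup>T *\<^sub>v (P *\<^sub>v x)) \<bullet> x"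
    using transpose_vec_mult_scalar[OF P(1) x, of "P *\<^sub>v x"] P(1) x by simp
  also have "P\<^sup>T *\<^sub>v (P *\<^sub>v x) = (P\<^sup>T * P) *\<^sub>v x"
    using P(1) x by (intro assoc_mult_mat_vec[symmetric]) auto
  finally show ?thesis
    using x by (simp add: P(2))
qed

definition normalize_vec :: "real vec \<Rightarrow> real vec" where
  "normalize_vec v = (1 / sqrt (v \<bullet> v)) \<cdot>\<^sub>v v"

lemma normalize_vec_carrier [simp]: "normalize_vec v \<in> carrier_vec n \<longleftrightarrow> v \<in> carrier_vec n"
  by (simp add: normalize_vec_def)

lemma orthonormal_mat_of_normalized_cols:
  assumes ws: "set ws \<subseteq> carrier_vec n" "corthogonal ws" "length ws = n"
  shows "orthonormal_mat n (mat_of_cols n (map normalize_vec ws))"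
proof -
  let ?W = "mat_of_cols n (map normalize_vec ws)"
  have W: "?W \<in> carrier_mat n n"
    using mat_of_cols_carrier(1)[of n "map normalize_vec ws"] ws(3) by simp
  have carrier: "ws ! i \<in> carrier_vec n" if "i < n" for i
    using ws that by auto
  have "conjugate w = w" for w :: "real vec"
    by (intro eq_vecI) auto
  then have orthogonal: "ws ! i \<bullet> ws ! j = 0 \<longleftrightarrow> i \<noteq> j" if "i < n" "j < n" for i j
    using corthogonalD[OF ws(2)] ws(3) that by simp
  have positive: "ws ! i \<bullet> ws ! i > 0" if "i < n" for i
    using orthogonal[OF that that]
    by (auto simp: scalar_prod_def less_le intro!: sum_nonneg)
  have "?W\<^sup>T * ?W = 1\<^sub>m n"
  proof (rule eq_matI)
    fix i j assume "i < dim_row (1\<^sub>m n :: real mat)" "j < dim_col (1\<^sub>m n :: real mat)"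
    then have ij: "i < n" "j < n"
      by simp_all
    then have "(?W\<^sup>T * ?W) $$ (i, j) = normalize_vec (ws ! i) \<bullet> normalize_vec (ws ! j)"
      using W ws(3) carrier by simp
    also have "\<dots> = 1\<^sub>m n $$ (i, j)"
      using ij carrier[of i] carrier[of j] orthogonal positive[of i]
      by (auto simp: normalize_vec_def less_imp_le)
    finally show "(?W\<^sup>T * ?W) $$ (i, j) = 1\<^sub>m n $$ (i, j)" .
  qed (use W in auto)
  with W show ?thesis
    by (simp add: orthonormal_mat_def)
qed

lemma orthonormal_mat_completion:
  assumes v: "v \<in> carrier_vec n" "v \<noteq> 0\<^sub>v n"
  shows "\<exists>W. orthonormal_mat n W \<and> col W 0 = normalize_vec v"
proof -
  interpret cof_vec_space n "TYPE(real)" .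
  define ws where "ws = gram_schmidt n (basis_completion v)"
  note basis = basis_completion[OF v]
  have n: "n > 0"
    using v by (cases n) auto
  then have "basis_completion v = v # tl (basis_completion v)"
    using basis(6,7) by (cases "basis_completion v") auto
  then have hd_ws: "hd ws = v"
    unfolding ws_def using gram_schmidt_hd[OF v(1)] by metis
  have ws: "set ws \<subseteq> carrier_vec n" "corthogonal ws" "length ws = n"
    using gram_schmidt_result[OF basis(2,4,5) ws_def] basis(6) by auto
  have "col (mat_of_cols n (map normalize_vec ws)) 0 = normalize_vec v"
    using n hd_ws ws(3) v(1) by (cases ws) (simp_all add: col_mat_of_cols)
  then show ?thesis
    using orthonormal_mat_of_normalized_cols[OF ws] by blast
qed

definition orthogonally_diagonalizable :: "nat \<Rightarrow> 'a :: field mat \<Rightarrow> bool" where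
  "orthogonally_diagonalizable n A \<longleftrightarrow> (\<exists>P f. orthonormal_mat n P \<and> P\<^sup>T * A * P = mat_diag n f)"

lemma orthogonally_diagonalizable_conjugate:
  assumes A: "A \<in> carrier_mat n n" and "orthonormal_mat n W"
    and "orthogonally_diagonalizable n (W\<^sup>T * A * W)"
  shows "orthogonally_diagonalizable n A"
proof -
  obtain P f where P: "orthonormal_mat n P" and diag: "P\<^sup>T * (W\<^sup>T * A * W) * P = mat_diag n f"
    using assms(3) by (auto simp: orthogonally_diagonalizable_def)
  have "(W * P)\<^sup>T * A * (W * P) = P\<^sup>T * (W\<^sup>T * A * W) * P"
    using A orthonormal_matD(1)[OF assms(2)] orthonormal_matD(1)[OF P]
    by (simp add: transpose_mult[of _ n n _ n] mult_carrier_mat[of _ n n _ n]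
        assoc_mult_mat[of _ n n _ n _ n])
  then show ?thesis
    unfolding orthogonally_diagonalizable_def
    using orthonormal_mat_mult[OF assms(2) P] diag by metis
qed

lemma orthogonally_diagonalizable_block:
  assumes C: "C \<in> carrier_mat n n" and "orthogonally_diagonalizable n C"
  shows "orthogonally_diagonalizable (Suc n)
    (four_block_mat (mat_diag 1 (\<lambda>_. e)) (0\<^sub>m 1 n) (0\<^sub>m n 1) C)"
    (is "orthogonally_diagonalizable _ ?B")
proof -
  obtain P f where P: "orthonormal_mat n P" and diag: "P\<^sup>T * C * P = mat_diag n f"
    using assms(2) by (auto simp: orthogonally_diagonalizable_def)
  let ?U = "four_block_mat (1\<^sub>m 1) (0\<^sub>m 1 n) (0\<^sub>m n 1) P"
  have "?U\<^sup>T = four_block_mat (1\<^sub>m 1) (0\<^sub>m 1 n) (0\<^sub>m n 1) P\<^sup>T"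
    using orthonormal_matD(1)[OF P] by (simp add: transpose_four_block_mat[of _ 1 1 _ n _ n])
  then have "?U\<^sup>T * ?B * ?U = four_block_mat (mat_diag 1 (\<lambda>_. e)) (0\<^sub>m 1 n) (0\<^sub>m n 1) (P\<^sup>T * C * P)"
    using orthonormal_matD(1)[OF P] C mat_diag_dim[of 1 "\<lambda>_. e"]
    by (simp add: mult_block_diagonal_mat mult_carrier_mat[of _ n n _ n]
        del: One_nat_def mat_diag_dim)
  also have "\<dots> = mat_diag (Suc n) (case_nat e f)"
    by (auto simp: diag mat_diag_def four_block_mat_def Let_def split: nat.splits intro!: eq_matI)
  finally show ?thesis
    unfolding orthogonally_diagonalizable_def using orthonormal_mat_one_block[OF P] by blast
qed

lemma symmetric_mat_eigenvector_block:
  fixes A :: "'a :: field mat"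
  assumes A: "A \<in> carrier_mat (Suc n) (Suc n)" and sym: "A\<^sup>T = A" and "orthonormal_mat (Suc n) W"
    and eigen: "A *\<^sub>v col W 0 = e \<cdot>\<^sub>v col W 0"
  obtains C where "C \<in> carrier_mat n n" and "C\<^sup>T = C"
    and "W\<^sup>T * A * W = four_block_mat (mat_diag 1 (\<lambda>_. e)) (0\<^sub>m 1 n) (0\<^sub>m n 1) C"
proof -
  let ?B = "W\<^sup>T * A * W"
  note W = orthonormal_matD[OF assms(3)]
  note mat_rules = mult_carrier_mat[of _ "Suc n" "Suc n" _ "Suc n"]
    assoc_mult_mat[of _ "Suc n" "Suc n" _ "Suc n" _ "Suc n"]
    transpose_mult[of _ "Suc n" "Suc n" _ "Suc n"]
  have B: "?B \<in> carrier_mat (Suc n) (Suc n)"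
    using A W(1) by simp
  have "?B\<^sup>T = ?B"
    using A W(1) sym by (simp add: mat_rules)
  then have B_sym: "?B $$ (i, j) = ?B $$ (j, i)" if "i < Suc n" "j < Suc n" for i j
    using B that by (metis carrier_matD index_transpose_mat(1))
  have "col ?B 0 = W\<^sup>T *\<^sub>v (A *\<^sub>v col W 0)"
    using A W(1) col_mult2[of "W\<^sup>T" "Suc n" "Suc n" "A * W" "Suc n" 0] col_mult2[OF A W(1), of 0]
    by (simp add: mat_rules)
  also have "\<dots> = e \<cdot>\<^sub>v (W\<^sup>T *\<^sub>v col W 0)"
    unfolding eigen using W(1) by (intro mult_mat_vec) (auto intro: carrier_vecI)
  also have "W\<^sup>T *\<^sub>v col W 0 = unit_vec (Suc n) 0"
    using W(1) col_mult2[of "W\<^sup>T" "Suc n" "Suc n" W "Suc n" 0] by (simp add: W(2))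
  finally have col_0: "?B $$ (i, 0) = (if i = 0 then e else 0)" if "i < Suc n" for i
    using that B by (auto simp: vec_eq_iff)
  define C where "C = mat n n (\<lambda>(i, j). ?B $$ (Suc i, Suc j))"
  have "?B = four_block_mat (mat_diag 1 (\<lambda>_. e)) (0\<^sub>m 1 n) (0\<^sub>m n 1) C"
    using B col_0 B_sym[of 0]
    by (intro eq_matI) (auto simp: C_def mat_diag_def four_block_mat_def Let_def)
  moreover have "C \<in> carrier_mat n n" "C\<^sup>T = C"
    by (auto simp: C_def B_sym intro!: eq_matI)
  ultimately show thesis
    using that by blast
qed

theorem symmetric_mat_orthogonally_diagonalizable:
  fixes A :: "real mat"
  assumes "A \<in> carrier_mat n n" and "A\<^sup>T = A"
  shows "orthogonally_diagonalizable n A"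
  using assms
proof (induction n arbitrary: A)
  case 0
  have "orthonormal_mat 0 (1\<^sub>m 0 :: real mat)" "(1\<^sub>m 0)\<^sup>T * A * 1\<^sub>m 0 = mat_diag 0 (\<lambda>_. 0)"
    using 0 by (auto simp: orthonormal_mat_def mat_diag_def)
  then show ?case
    unfolding orthogonally_diagonalizable_def by blast
next
  case (Suc n)
  obtain e v where v: "v \<in> carrier_vec (Suc n)" "v \<noteq> 0\<^sub>v (Suc n)" and eigen: "A *\<^sub>v v = e \<cdot>\<^sub>v v"
    using symmetric_mat_has_eigenvalue[OF Suc.prems] Suc.prems(1)
    unfolding eigenvalue_def eigenvector_def by auto
  obtain W where W: "orthonormal_mat (Suc n) W" and "col W 0 = normalize_vec v"
    using orthonormal_mat_completion[OF v] by blast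
  then have "A *\<^sub>v col W 0 = e \<cdot>\<^sub>v col W 0"
    using Suc.prems(1) v eigen
    by (simp add: normalize_vec_def mult_mat_vec smult_smult_assoc mult.commute)
  then obtain C where C: "C \<in> carrier_mat n n" "C\<^sup>T = C"
    and block: "W\<^sup>T * A * W = four_block_mat (mat_diag 1 (\<lambda>_. e)) (0\<^sub>m 1 n) (0\<^sub>m n 1) C"
    by (rule symmetric_mat_eigenvector_block[OF Suc.prems W])
  have "orthogonally_diagonalizable (Suc n) (W\<^sup>T * A * W)"
    unfolding block using C(1) Suc.IH[OF C] by (rule orthogonally_diagonalizable_block)
  then show ?case
    by (rule orthogonally_diagonalizable_conjugate[OF Suc.prems(1) W])
qed

section \<open>Eigenvalues of large modulus\<close>

lemma exists_nonzero_vec_orthogonal_to_few: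
  fixes rs :: "'a :: field vec list"
  assumes rs: "set rs \<subseteq> carrier_vec n" and few: "length rs < n"
  shows "\<exists>x \<in> carrier_vec n. x \<noteq> 0\<^sub>v n \<and> (\<forall>r \<in> set rs. r \<bullet> x = 0)"
proof -
  define M where
    "M = mat\<^sub>r n n (\<lambda>i. if i = n - 1 then 0\<^sub>v n else if i < length rs then rs ! i else 0\<^sub>v n)"
  have M: "M \<in> carrier_mat n n"
    by (simp add: M_def)
  have "det M = 0"
    unfolding M_def using few subsetD[OF rs nth_mem] by (intro det_row_0) auto
  then obtain x where x: "x \<in> carrier_vec n" "x \<noteq> 0\<^sub>v n" "M *\<^sub>v x = 0\<^sub>v n"
    using det_0_iff_vec_prod_zero[OF M] by blast
  have "rs ! i \<bullet> x = 0" if i: "i < length rs" for i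
  proof -
    have "rs ! i \<in> carrier_vec n"
      using rs i by auto
    then have "row M i = rs ! i"
      using i few by (auto simp: M_def)
    then have "rs ! i \<bullet> x = (M *\<^sub>v x) $ i"
      using i few M by simp
    then show ?thesis
      using i few by (simp add: x)
  qed
  then show ?thesis
    using x by (metis in_set_conv_nth)
qed

lemma eigenvalues_mset_orthogonal_diagonalization:
  assumes A: "A \<in> carrier_mat n n" and "orthonormal_mat n P" and diag: "P\<^sup>T * A * P = mat_diag n f"
  shows "eigenvalues_mset A = mset (map f [0..<n])"
proof -
  note P = orthonormal_matD[OF assms(2)]
  have "similar_mat_wit (P\<^sup>T * A * P) A P\<^sup>T P"
    by (rule similar_mat_witI[OF P(2,3)]) (use A P(1) in auto)
  then have "char_poly A = char_poly (mat_diag n f)"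
    unfolding diag using char_poly_similar by (metis similar_mat_def)
  also have "\<dots> = (\<Prod>a\<leftarrow>diag_mat (mat_diag n f). [:- a, 1:])"
    by (rule char_poly_upper_triangular[OF mat_diag_dim]) (auto simp: mat_diag_def)
  also have "diag_mat (mat_diag n f) = map f [0..<n]"
    by (auto simp: diag_mat_def mat_diag_def)
  finally have "char_poly A = (\<Prod>a\<leftarrow>map f [0..<n]. [:- a, 1:])" .
  moreover have "0 \<notin> set (map (\<lambda>a. [:- a, 1:]) (map f [0..<n]))"
    by auto
  ultimately show ?thesis
    using proots_prod_list by (fastforce simp: eigenvalues_mset_def o_def)
qed

lemma mat_diag_mult_vec:
  assumes "y \<in> carrier_vec n"
  shows "mat_diag n f *\<^sub>v y = vec n (\<lambda>i. f i * y $ i)"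
  using assms
  by (auto simp: mat_diag_def scalar_prod_def if_distrib if_distribR sum.If_cases
      intro!: eq_vecI cong: if_cong)

lemma mat_diag_scalar_prod_le:
  fixes f :: "nat \<Rightarrow> real"
  assumes y: "y \<in> carrier_vec n" and small: "\<And>i. i < n \<Longrightarrow> y $ i \<noteq> 0 \<Longrightarrow> \<bar>f i\<bar> \<le> r"
  shows "(mat_diag n f *\<^sub>v y) \<bullet> (mat_diag n f *\<^sub>v y) \<le> r\<^sup>2 * (y \<bullet> y)"
proof -
  have "(f i * y $ i)\<^sup>2 \<le> r\<^sup>2 * (y $ i)\<^sup>2" if "i < n" for i
  proof (cases "y $ i = 0")
    case False
    then have "\<bar>f i\<bar>\<^sup>2 \<le> r\<^sup>2"
      using small[OF that] by (intro power_mono) auto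
    then show ?thesis
      by (simp add: power_mult_distrib mult_right_mono)
  qed simp
  then have "(\<Sum>i = 0..<n. (f i * y $ i)\<^sup>2) \<le> (\<Sum>i = 0..<n. r\<^sup>2 * (y $ i)\<^sup>2)"
    by (intro sum_mono) simp
  then show ?thesis
    using y by (simp add: mat_diag_mult_vec scalar_prod_def sum_distrib_left flip: power2_eq_square)
qed

lemma scalar_prod_orthogonal_diagonalization:
  assumes A: "A \<in> carrier_mat n n" and "orthonormal_mat n P" and diag: "P\<^sup>T * A * P = mat_diag n f"
    and x: "x \<in> carrier_vec n"
  shows "(A *\<^sub>v x) \<bullet> (A *\<^sub>v x) = (mat_diag n f *\<^sub>v (P\<^sup>T *\<^sub>v x)) \<bullet> (mat_diag n f *\<^sub>v (P\<^sup>T *\<^sub>v x))"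
proof -
  note P = orthonormal_matD[OF assms(2)]
  have "P\<^sup>T *\<^sub>v (A *\<^sub>v x) = P\<^sup>T *\<^sub>v (A *\<^sub>v ((P * P\<^sup>T) *\<^sub>v x))"
    using x by (simp add: P(3))
  also have "\<dots> = mat_diag n f *\<^sub>v (P\<^sup>T *\<^sub>v x)"
    using A P(1) x
    by (simp add: mult_carrier_mat[of _ n n _ n] assoc_mult_mat_vec[of _ n n _ n] flip: diag)
  finally show ?thesis
    using orthonormal_mat_scalar_prod[OF orthonormal_mat_transpose[OF assms(2)], of "A *\<^sub>v x"] A x
    by simp
qed

lemma symmetric_mat_ex_bounded_vec_orthogonal_to_few:
  fixes A :: "real mat"
  assumes A: "A \<in> carrier_mat n n" "A\<^sup>T = A" and rs: "set rs \<subseteq> carrier_vec n"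
    and few: "length rs + size {#e \<in># eigenvalues_mset A. \<bar>e\<bar> > r#} < n"
  shows "\<exists>x \<in> carrier_vec n. x \<noteq> 0\<^sub>v n \<and> (\<forall>u \<in> set rs. u \<bullet> x = 0) \<and>
    (A *\<^sub>v x) \<bullet> (A *\<^sub>v x) \<le> r\<^sup>2 * (x \<bullet> x)"
proof -
  obtain P f where P: "orthonormal_mat n P" and diag: "P\<^sup>T * A * P = mat_diag n f"
    using symmetric_mat_orthogonally_diagonalizable[OF A]
    by (auto simp: orthogonally_diagonalizable_def)
  note P_carrier = orthonormal_matD(1)[OF P]
  define large where "large = filter (\<lambda>i. \<bar>f i\<bar> > r) [0..<n]"
  have "{#e \<in># eigenvalues_mset A. \<bar>e\<bar> > r#} = mset (map f large)"
    unfolding eigenvalues_mset_orthogonal_diagonalization[OF A(1) P diag]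
    by (simp only: large_def filter_map o_def flip: mset_filter)
  then have "length (rs @ map (col P) large) < n"
    using few by simp
  moreover have "set (rs @ map (col P) large) \<subseteq> carrier_vec n"
    using rs P_carrier by auto
  ultimately obtain x where x: "x \<in> carrier_vec n" "x \<noteq> 0\<^sub>v n"
    and orthogonal: "\<forall>u \<in> set (rs @ map (col P) large). u \<bullet> x = 0"
    using exists_nonzero_vec_orthogonal_to_few by blast
  define y where "y = P\<^sup>T *\<^sub>v x"
  have y: "y \<in> carrier_vec n"
    using P_carrier x by (simp add: y_def)
  have small: "\<bar>f i\<bar> \<le> r" if "i < n" "y $ i \<noteq> 0" for i
    using orthogonal that P_carrier by (auto simp: y_def large_def not_less)
  have "(A *\<^sub>v x) \<bullet> (A *\<^sub>v x) = (mat_diag n f *\<^sub>v y) \<bullet> (mat_diag n f *\<^sub>v y)"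
    unfolding y_def using A(1) P diag x(1) by (rule scalar_prod_orthogonal_diagonalization)
  also have "\<dots> \<le> r\<^sup>2 * (y \<bullet> y)"
    using y small by (rule mat_diag_scalar_prod_le)
  also have "y \<bullet> y = x \<bullet> x"
    unfolding y_def using orthonormal_mat_transpose[OF P] x(1) by (rule orthonormal_mat_scalar_prod)
  finally show ?thesis
    using x orthogonal by auto
qed

lemma symmetric_mat_ex_bounded_vec_supported_on:
  fixes A :: "real mat"
  assumes A: "A \<in> carrier_mat n n" "A\<^sup>T = A" and J: "J \<subseteq> {..<n}"
    and few: "size {#e \<in># eigenvalues_mset A. \<bar>e\<bar> > r#} < card J"
  shows "\<exists>x \<in> carrier_vec n. x \<noteq> 0\<^sub>v n \<and> (\<forall>i<n. i \<notin> J \<longrightarrow> x $ i = 0) \<and>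
    (A *\<^sub>v x) \<bullet> (A *\<^sub>v x) \<le> r\<^sup>2 * (x \<bullet> x)"
proof -
  define outside where "outside = filter (\<lambda>i. i \<notin> J) [0..<n]"
  have "length outside = card ({..<n} - J)"
    unfolding outside_def by (subst distinct_card[symmetric]) (auto intro: arg_cong[of _ _ card])
  then have "length outside + card J = n"
    using J card_mono[OF _ J] by (simp add: card_Diff_subset finite_subset)
  with few have "length (map (unit_vec n) outside) + size {#e \<in># eigenvalues_mset A. \<bar>e\<bar> > r#} < n"
    by simp
  moreover have "set (map (unit_vec n) outside) \<subseteq> carrier_vec n"
    by auto
  ultimately have "\<exists>x \<in> carrier_vec n. x \<noteq> 0\<^sub>v n \<and>
      (\<forall>u \<in> set (map (unit_vec n) outside). u \<bullet> x = 0) \<and>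
      (A *\<^sub>v x) \<bullet> (A *\<^sub>v x) \<le> r\<^sup>2 * (x \<bullet> x)"
    by (intro symmetric_mat_ex_bounded_vec_orthogonal_to_few[OF A])
  then show ?thesis
    by (auto simp: outside_def)
qed

lemma mult_product_ge_neg_half_squares:
  fixes c u v :: real
  shows "- (\<bar>c\<bar> * (u\<^sup>2 + v\<^sup>2) / 2) \<le> c * (u * v)"
proof -
  have "2 * \<bar>u * v\<bar> \<le> u\<^sup>2 + v\<^sup>2"
    using sum_squares_bound[of "\<bar>u\<bar>" "\<bar>v\<bar>"] by (simp add: abs_mult)
  then have "\<bar>c\<bar> * (2 * \<bar>u * v\<bar>) \<le> \<bar>c\<bar> * (u\<^sup>2 + v\<^sup>2)"
    by (rule mult_left_mono) simp
  then show ?thesis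
    using abs_ge_minus_self[of "c * (u * v)"] by (simp add: abs_mult)
qed

lemma quadratic_form_ge_diagonal_excess:
  fixes g :: "'i \<Rightarrow> 'i \<Rightarrow> real" and x :: "'i \<Rightarrow> real"
  assumes J: "finite J" and sym: "\<And>j k. g j k = g k j"
  shows "(\<Sum>j \<in> J. (g j j - (\<Sum>k \<in> J - {j}. \<bar>g j k\<bar>)) * (x j)\<^sup>2)
    \<le> (\<Sum>j \<in> J. \<Sum>k \<in> J. g j k * (x j * x k))"
proof -
  define h where "h j k = (if k = j then 0 else g j k)" for j k
  have diagonal: "(\<Sum>k \<in> J. g j k * (x j * x k)) = g j j * (x j)\<^sup>2 + (\<Sum>k \<in> J. h j k * (x j * x k))"
    and off_diagonal: "(\<Sum>k \<in> J. \<bar>h j k\<bar>) = (\<Sum>k \<in> J - {j}. \<bar>g j k\<bar>)" if "j \<in> J" for j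
    using J that by (auto simp: h_def sum.remove[of J j] power2_eq_square intro!: sum.cong)
  have h_sym: "h j k = h k j" for j k
    by (auto simp: h_def sym)
  have "(\<Sum>j \<in> J. \<Sum>k \<in> J. \<bar>h j k\<bar> * (x k)\<^sup>2) = (\<Sum>j \<in> J. \<Sum>k \<in> J. \<bar>h j k\<bar> * (x j)\<^sup>2)"
    by (subst sum.swap) (simp add: h_sym)
  then have "(\<Sum>j \<in> J. \<Sum>k \<in> J. \<bar>h j k\<bar> * ((x j)\<^sup>2 + (x k)\<^sup>2) / 2) =
      (\<Sum>j \<in> J. (\<Sum>k \<in> J. \<bar>h j k\<bar>) * (x j)\<^sup>2)"
    by (simp add: distrib_left sum.distrib sum_distrib_right flip: sum_divide_distrib)
  moreover have "(\<Sum>j \<in> J. \<Sum>k \<in> J. - (\<bar>h j k\<bar> * ((x j)\<^sup>2 + (x k)\<^sup>2) / 2))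
      \<le> (\<Sum>j \<in> J. \<Sum>k \<in> J. h j k * (x j * x k))"
    by (intro sum_mono mult_product_ge_neg_half_squares)
  ultimately have "(\<Sum>j \<in> J. g j j * (x j)\<^sup>2) - (\<Sum>j \<in> J. (\<Sum>k \<in> J. \<bar>h j k\<bar>) * (x j)\<^sup>2)
      \<le> (\<Sum>j \<in> J. g j j * (x j)\<^sup>2 + (\<Sum>k \<in> J. h j k * (x j * x k)))"
    by (simp add: sum.distrib sum_negf)
  then show ?thesis
    by (simp add: diagonal off_diagonal left_diff_distrib sum_subtractf)
qed

lemma diagonally_dominant_quadratic_form_gt:
  fixes g :: "'i \<Rightarrow> 'i \<Rightarrow> real" and x :: "'i \<Rightarrow> real"
  assumes J: "finite J" and sym: "\<And>j k. g j k = g k j"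
    and dominant: "\<And>j. j \<in> J \<Longrightarrow> (\<Sum>k \<in> J - {j}. \<bar>g j k\<bar>) + s < g j j"
    and nonzero: "\<exists>j \<in> J. x j \<noteq> 0"
  shows "s * (\<Sum>j \<in> J. (x j)\<^sup>2) < (\<Sum>j \<in> J. \<Sum>k \<in> J. g j k * (x j * x k))"
proof -
  have excess: "s < g j j - (\<Sum>k \<in> J - {j}. \<bar>g j k\<bar>)" if "j \<in> J" for j
    using dominant[OF that] by simp
  have "(\<Sum>j \<in> J. s * (x j)\<^sup>2) < (\<Sum>j \<in> J. (g j j - (\<Sum>k \<in> J - {j}. \<bar>g j k\<bar>)) * (x j)\<^sup>2)"
  proof (rule sum_strict_mono_ex1[OF J])
    show "\<forall>j \<in> J. s * (x j)\<^sup>2 \<le> (g j j - (\<Sum>k \<in> J - {j}. \<bar>g j k\<bar>)) * (x j)\<^sup>2"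
      by (intro ballI mult_right_mono less_imp_le[OF excess]) auto
    show "\<exists>j \<in> J. s * (x j)\<^sup>2 < (g j j - (\<Sum>k \<in> J - {j}. \<bar>g j k\<bar>)) * (x j)\<^sup>2"
      using nonzero excess by (meson mult_strict_right_mono zero_less_power2)
  qed
  also have "\<dots> \<le> (\<Sum>j \<in> J. \<Sum>k \<in> J. g j k * (x j * x k))"
    using J sym by (rule quadratic_form_ge_diagonal_excess)
  finally show ?thesis
    by (simp add: sum_distrib_left)
qed

lemma sum_outer_products_eq_sum_squares:
  fixes a :: "'t \<Rightarrow> 'i \<Rightarrow> 'a :: comm_semiring_1"
  shows "(\<Sum>j \<in> J. \<Sum>k \<in> J. (\<Sum>t \<in> T. a t j * a t k) * (x j * x k)) =
    (\<Sum>t \<in> T. (\<Sum>j \<in> J. a t j * x j)\<^sup>2)"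
proof -
  have "(\<Sum>t \<in> T. (\<Sum>j \<in> J. a t j * x j)\<^sup>2) =
      (\<Sum>t \<in> T. \<Sum>j \<in> J. \<Sum>k \<in> J. (a t j * a t k) * (x j * x k))"
    by (simp add: power2_eq_square sum_product ac_simps)
  also have "\<dots> = (\<Sum>j \<in> J. \<Sum>t \<in> T. \<Sum>k \<in> J. (a t j * a t k) * (x j * x k))"
    by (rule sum.swap)
  also have "\<dots> = (\<Sum>j \<in> J. \<Sum>k \<in> J. \<Sum>t \<in> T. (a t j * a t k) * (x j * x k))"
    by (intro sum.cong refl sum.swap)
  finally show ?thesis
    by (simp add: sum_distrib_right)
qed

theorem card_le_size_large_eigenvalues:
  fixes A :: "real mat"
  assumes A: "A \<in> carrier_mat n n" "A\<^sup>T = A" and J: "J \<subseteq> {..<n}" and T: "T \<subseteq> {..<n}"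
    and dominant: "\<And>j. j \<in> J \<Longrightarrow> (\<Sum>k \<in> J - {j}. \<bar>\<Sum>t \<in> T. A $$ (t, j) * A $$ (t, k)\<bar>) + r\<^sup>2
      < (\<Sum>t \<in> T. (A $$ (t, j))\<^sup>2)"
  shows "card J \<le> size {#e \<in># eigenvalues_mset A. \<bar>e\<bar> > r#}"
proof (rule ccontr)
  assume "\<not> ?thesis"
  then have "size {#e \<in># eigenvalues_mset A. \<bar>e\<bar> > r#} < card J"
    by simp
  then obtain x where x: "x \<in> carrier_vec n" "x \<noteq> 0\<^sub>v n" and supp: "\<And>i. i < n \<Longrightarrow> i \<notin> J \<Longrightarrow> x $ i = 0"
    and bounded: "(A *\<^sub>v x) \<bullet> (A *\<^sub>v x) \<le> r\<^sup>2 * (x \<bullet> x)"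
    using symmetric_mat_ex_bounded_vec_supported_on[OF A J] by blast
  have J_finite: "finite J"
    using J finite_subset by blast
  have sum_J: "(\<Sum>i = 0..<n. c i * x $ i) = (\<Sum>j \<in> J. c j * x $ j)" for c
    using J supp by (intro sum.mono_neutral_right) auto
  have "\<exists>j \<in> J. x $ j \<noteq> 0"
    using x supp by (metis eq_vecI carrier_vecD index_zero_vec)
  then have "r\<^sup>2 * (\<Sum>j \<in> J. (x $ j)\<^sup>2) <
      (\<Sum>j \<in> J. \<Sum>k \<in> J. (\<Sum>t \<in> T. A $$ (t, j) * A $$ (t, k)) * (x $ j * x $ k))"
    using dominant J_finite
    by (intro diagonally_dominant_quadratic_form_gt) (simp_all add: mult.commute power2_eq_square)
  also have "\<dots> = (\<Sum>t \<in> T. (\<Sum>j \<in> J. A $$ (t, j) * x $ j)\<^sup>2)"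
    by (rule sum_outer_products_eq_sum_squares)
  also have "\<dots> \<le> (\<Sum>t = 0..<n. (\<Sum>j \<in> J. A $$ (t, j) * x $ j)\<^sup>2)"
    using T by (intro sum_mono2) auto
  also have "\<dots> = (A *\<^sub>v x) \<bullet> (A *\<^sub>v x)"
    using A(1) x(1) by (simp add: scalar_prod_def sum_J power2_eq_square)
  also have "\<dots> \<le> r\<^sup>2 * (\<Sum>j \<in> J. (x $ j)\<^sup>2)"
    using bounded x(1) by (simp add: scalar_prod_def sum_J power2_eq_square)
  finally show False
    by simp
qed

section \<open>Graphs without nearly orthogonal Seidel columns\<close>

definition seidel_entry :: "('a \<Rightarrow> 'a \<Rightarrow> bool) \<Rightarrow> 'a \<Rightarrow> 'a \<Rightarrow> real" where
  "seidel_entry R x y = (if x = y then 0 else if R x y then -1 else 1)"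

definition seidel_inner :: "('a \<Rightarrow> 'a \<Rightarrow> bool) \<Rightarrow> 'a set \<Rightarrow> 'a \<Rightarrow> 'a \<Rightarrow> real" where
  "seidel_inner R T x y = (\<Sum>t \<in> T. seidel_entry R t x * seidel_entry R t y)"

lemma seidel_inner_commute: "seidel_inner R T x y = seidel_inner R T y x"
  by (simp add: seidel_inner_def mult.commute)

definition nearly_orthogonal :: "('a \<Rightarrow> 'a \<Rightarrow> bool) \<Rightarrow> 'a set \<Rightarrow> 'a set \<Rightarrow> bool" where
  "nearly_orthogonal R T J \<longleftrightarrow> pairwise (\<lambda>x y. \<bar>seidel_inner R T x y\<bar> \<le> 1) J"

lemma ex_nearly_orthogonal_tripleI:
  assumes "{x, y, z} \<subseteq> T" and "distinct [x, y, z]"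
    and "\<bar>seidel_inner R T x y\<bar> \<le> 1" "\<bar>seidel_inner R T x z\<bar> \<le> 1" "\<bar>seidel_inner R T y z\<bar> \<le> 1"
  shows "\<exists>J \<subseteq> T. card J = 3 \<and> nearly_orthogonal R T J"
proof -
  have "nearly_orthogonal R T {x, y, z}"
    using assms(3-5) by (auto simp: nearly_orthogonal_def pairwise_insert seidel_inner_commute)
  then show ?thesis
    using assms(1,2) by (intro exI[of _ "{x, y, z}"]) auto
qed

definition induced_C4 :: "('a \<Rightarrow> 'a \<Rightarrow> bool) \<Rightarrow> 'a \<Rightarrow> 'a \<Rightarrow> 'a \<Rightarrow> 'a \<Rightarrow> bool" where
  "induced_C4 R a b c d \<longleftrightarrow> distinct [a, b, c, d] \<and>
     R a b \<and> R b c \<and> R c d \<and> R d a \<and> \<not> R a c \<and> \<not> R b d"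

definition induced_2K2 :: "('a \<Rightarrow> 'a \<Rightarrow> bool) \<Rightarrow> 'a \<Rightarrow> 'a \<Rightarrow> 'a \<Rightarrow> 'a \<Rightarrow> bool" where
  "induced_2K2 R a b c d \<longleftrightarrow> distinct [a, b, c, d] \<and>
     R a b \<and> R c d \<and> \<not> R a c \<and> \<not> R a d \<and> \<not> R b c \<and> \<not> R b d"

definition induced_P4 :: "('a \<Rightarrow> 'a \<Rightarrow> bool) \<Rightarrow> 'a \<Rightarrow> 'a \<Rightarrow> 'a \<Rightarrow> 'a \<Rightarrow> bool" where
  "induced_P4 R a b c d \<longleftrightarrow> distinct [a, b, c, d] \<and>
     R a b \<and> R b c \<and> R c d \<and> \<not> R a c \<and> \<not> R a d \<and> \<not> R b d"

definition induced_P3_K1 :: "('a \<Rightarrow> 'a \<Rightarrow> bool) \<Rightarrow> 'a \<Rightarrow> 'a \<Rightarrow> 'a \<Rightarrow> 'a \<Rightarrow> bool" where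
  "induced_P3_K1 R a b c d \<longleftrightarrow> distinct [a, b, c, d] \<and>
     R a b \<and> R b c \<and> \<not> R a c \<and> \<not> R a d \<and> \<not> R b d \<and> \<not> R c d"

definition induced_paw :: "('a \<Rightarrow> 'a \<Rightarrow> bool) \<Rightarrow> 'a \<Rightarrow> 'a \<Rightarrow> 'a \<Rightarrow> 'a \<Rightarrow> bool" where
  "induced_paw R a b c d \<longleftrightarrow> distinct [a, b, c, d] \<and>
     R a b \<and> R b c \<and> R a c \<and> R a d \<and> \<not> R b d \<and> \<not> R c d"

definition forbidden_quadruple :: "('a \<Rightarrow> 'a \<Rightarrow> bool) \<Rightarrow> 'a \<Rightarrow> 'a \<Rightarrow> 'a \<Rightarrow> 'a \<Rightarrow> bool" where
  "forbidden_quadruple R a b c d \<longleftrightarrow>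
     induced_C4 R a b c d \<or> induced_2K2 R a b c d \<or> induced_P4 R a b c d \<or>
     induced_P3_K1 R a b c d \<or> induced_paw R a b c d"

lemma forbidden_quadruple_distinct:
  assumes "forbidden_quadruple R a b c d"
  shows "distinct [a, b, c, d]"
  using assms
  by (auto simp: forbidden_quadruple_def induced_C4_def induced_2K2_def induced_P4_def
      induced_P3_K1_def induced_paw_def)

lemma forbidden_quadruple_ex_nearly_orthogonal:
  assumes sym: "symp R" and isolated: "\<And>x. \<not> R v x" and v: "v \<notin> {a, b, c, d}"
    and forbidden: "forbidden_quadruple R a b c d"
  shows "\<exists>J \<subseteq> {a, b, c, d, v}. card J = 3 \<and> nearly_orthogonal R {a, b, c, d, v} J"
    (is "\<exists>J \<subseteq> ?T. _")
proof -
  have distinct: "distinct [a, b, c, d, v]"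
    using forbidden_quadruple_distinct[OF forbidden] v by auto
  have inner: "seidel_inner R ?T x y = seidel_entry R a x * seidel_entry R a y
    + seidel_entry R b x * seidel_entry R b y + seidel_entry R c x * seidel_entry R c y
    + seidel_entry R d x * seidel_entry R d y + seidel_entry R v x * seidel_entry R v y" for x y
    using distinct by (simp add: seidel_inner_def add.assoc)
  have "R y x \<longleftrightarrow> R x y" for x y
    using sympD[OF sym] by blast
  then have "R b a \<longleftrightarrow> R a b" "R c a \<longleftrightarrow> R a c" "R d a \<longleftrightarrow> R a d" "R c b \<longleftrightarrow> R b c"
    "R d b \<longleftrightarrow> R b d" "R d c \<longleftrightarrow> R c d" "\<not> R x v" for x
    using isolated by blast+
  note entries = this isolated inner seidel_entry_def
  txt \<open>
    Except in the case of \<open>P\<^sub>4\<close>, the five columns split into two pairs with inner product \<open>\<plusminus>3\<close> and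
    a single column; the triples chosen below are transversals.
  \<close>
  consider (C4) "induced_C4 R a b c d" | (two_K2) "induced_2K2 R a b c d"
    | (P4) "induced_P4 R a b c d" | (P3_K1) "induced_P3_K1 R a b c d"
    | (paw) "induced_paw R a b c d"
    using forbidden unfolding forbidden_quadruple_def by blast
  then show ?thesis
  proof cases
    case C4
    then show ?thesis
      using distinct
      by (intro ex_nearly_orthogonal_tripleI[of a b v]) (auto simp: entries induced_C4_def)
  next
    case two_K2
    then show ?thesis
      using distinct
      by (intro ex_nearly_orthogonal_tripleI[of a c v]) (auto simp: entries induced_2K2_def)
  next
    case P4
    then show ?thesis
      using distinct
      by (intro ex_nearly_orthogonal_tripleI[of a b c]) (auto simp: entries induced_P4_def)
  next
    case P3_K1
    then show ?thesis
      using distinct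
      by (intro ex_nearly_orthogonal_tripleI[of a b d]) (auto simp: entries induced_P3_K1_def)
  next
    case paw
    then show ?thesis
      using distinct
      by (intro ex_nearly_orthogonal_tripleI[of a b d]) (auto simp: entries induced_paw_def)
  qed
qed

definition induced_P3 :: "('a \<Rightarrow> 'a \<Rightarrow> bool) \<Rightarrow> 'a \<Rightarrow> 'a \<Rightarrow> 'a \<Rightarrow> bool" where
  "induced_P3 R a b c \<longleftrightarrow> distinct [a, b, c] \<and> R a b \<and> R b c \<and> \<not> R a c"

definition co_adjacent :: "('a \<Rightarrow> 'a \<Rightarrow> bool) \<Rightarrow> 'a \<Rightarrow> 'a \<Rightarrow> bool" where
  "co_adjacent R x y \<longleftrightarrow> x \<noteq> y \<and> \<not> R x y"

definition clique_with_isolated_on :: "'a set \<Rightarrow> ('a \<Rightarrow> 'a \<Rightarrow> bool) \<Rightarrow> bool" where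
  "clique_with_isolated_on V R \<longleftrightarrow>
     (\<exists>K \<subseteq> V. \<forall>x \<in> V. \<forall>y \<in> V. R x y \<longleftrightarrow> x \<noteq> y \<and> x \<in> K \<and> y \<in> K)"

lemma clique_with_isolated_on_if_P3_2K2_free:
  assumes sym: "symp R" and irrefl: "irreflp R"
    and P3_free: "\<And>a b c. {a, b, c} \<subseteq> V \<Longrightarrow> \<not> induced_P3 R a b c"
    and two_K2_free: "\<And>a b c d. {a, b, c, d} \<subseteq> V \<Longrightarrow> \<not> induced_2K2 R a b c d"
  shows "clique_with_isolated_on V R"
proof -
  have neq: "x \<noteq> y" if "R x y" for x y
    using that irrefl by (auto dest: irreflpD)
  have trans: "R x z" if "{x, y, z} \<subseteq> V" "R x y" "R y z" "x \<noteq> z" for x y z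
    using P3_free[OF that(1)] that neq by (auto simp: induced_P3_def)
  let ?K = "{x \<in> V. \<exists>y \<in> V. R x y}"
  have clique: "R x y" if K: "x \<in> ?K" "y \<in> ?K" and "x \<noteq> y" for x y
  proof (rule ccontr)
    assume xy: "\<not> R x y"
    obtain x' y' where x': "x' \<in> V" "R x x'" "R x' x" and y': "y' \<in> V" "R y y'" "R y' y"
      using K sympD[OF sym] by blast
    have "\<not> R x y'" "\<not> R x' y"
      using trans[of x y' y] trans[of x x' y] K x' y' xy \<open>x \<noteq> y\<close> by auto
    moreover from this have "\<not> R x' y'"
      using trans[of x x' y'] K x' y' xy by auto
    ultimately have "induced_2K2 R x x' y y'"
      using x' y' xy \<open>x \<noteq> y\<close> neq by (auto simp: induced_2K2_def)
    then show False
      using two_K2_free[of x x' y y'] K x' y' by auto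
  qed
  have "R x y \<longleftrightarrow> x \<noteq> y \<and> x \<in> ?K \<and> y \<in> ?K" if "x \<in> V" "y \<in> V" for x y
    using that clique[of x y] neq[of x y] sympD[OF sym] by blast
  then show ?thesis
    unfolding clique_with_isolated_on_def by (intro exI[of _ ?K]) blast
qed

context
  fixes V :: "'a set" and R :: "'a \<Rightarrow> 'a \<Rightarrow> bool"
  assumes sym: "symp R" and irrefl: "irreflp R"
    and free: "\<And>a b c d. {a, b, c, d} \<subseteq> V \<Longrightarrow> \<not> forbidden_quadruple R a b c d"
begin

lemma P3_center_dominating:
  assumes abc: "{a, b, c} \<subseteq> V" "induced_P3 R a b c" and d: "d \<in> V" "d \<noteq> b"
  shows "R b d"
proof (rule ccontr)
  assume "\<not> R b d"
  have swap: "R x y \<longleftrightarrow> R y x" for x y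
    using sympD[OF sym] by blast
  have P3: "distinct [a, b, c, d]" "R a b" "R b c" "\<not> R a c"
    using abc(2) d(2) \<open>\<not> R b d\<close> swap[of a b] by (auto simp: induced_P3_def)
  have "induced_C4 R a b c d" if "R a d" "R c d"
    using that P3 \<open>\<not> R b d\<close> swap[of d a] by (simp add: induced_C4_def)
  moreover have "induced_P4 R c b a d" if "R a d" "\<not> R c d"
    using that P3 \<open>\<not> R b d\<close> swap[of c b] swap[of b a] swap[of c a] by (auto simp: induced_P4_def)
  moreover have "induced_P4 R a b c d" if "\<not> R a d" "R c d"
    using that P3 \<open>\<not> R b d\<close> by (simp add: induced_P4_def)
  moreover have "induced_P3_K1 R a b c d" if "\<not> R a d" "\<not> R c d"
    using that P3 \<open>\<not> R b d\<close> by (simp add: induced_P3_K1_def)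
  ultimately have "forbidden_quadruple R a b c d \<or> forbidden_quadruple R c b a d"
    unfolding forbidden_quadruple_def by blast
  then show False
    using free[of a b c d] free[of c b a d] abc(1) d(1) by auto
qed

lemma co_P3_free_if_P3:
  assumes abc: "{a, b, c} \<subseteq> V" "induced_P3 R a b c" and xyz: "{x, z, y} \<subseteq> V"
  shows "\<not> induced_P3 (co_adjacent R) x z y"
proof
  assume "induced_P3 (co_adjacent R) x z y"
  then have xyz': "distinct [x, y, z]" "R x y" "\<not> R x z" "\<not> R z x" "\<not> R y z" "\<not> R z y"
    using sympD[OF sym] by (auto simp: induced_P3_def co_adjacent_def)
  have dominating: "R b u" if "u \<in> {x, y, z}" "u \<noteq> b" for u
    using P3_center_dominating[OF abc] xyz that by auto
  have "b \<notin> {x, y, z}"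
    using xyz' dominating by auto
  then have "induced_paw R b x y z"
    using xyz' dominating by (auto simp: induced_paw_def)
  then show False
    using free[of b x y z] abc(1) xyz by (auto simp: forbidden_quadruple_def)
qed

theorem clique_with_isolated_or_complement:
  "clique_with_isolated_on V R \<or> clique_with_isolated_on V (co_adjacent R)"
proof (cases "\<exists>a b c. {a, b, c} \<subseteq> V \<and> induced_P3 R a b c")
  case True
  have "symp (co_adjacent R)" "irreflp (co_adjacent R)"
    using sympD[OF sym] by (auto simp: co_adjacent_def intro!: sympI irreflpI)
  moreover have "\<not> induced_P3 (co_adjacent R) x y z" if "{x, y, z} \<subseteq> V" for x y z
    using True co_P3_free_if_P3 that by blast
  moreover have "\<not> induced_2K2 (co_adjacent R) a b c d" if "{a, b, c, d} \<subseteq> V" for a b c d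
  proof
    assume "induced_2K2 (co_adjacent R) a b c d"
    then have "induced_C4 R a c b d"
      using sympD[OF sym] by (auto simp: induced_2K2_def induced_C4_def co_adjacent_def)
    then show False
      using free[of a c b d] that by (auto simp: forbidden_quadruple_def)
  qed
  ultimately show ?thesis
    using clique_with_isolated_on_if_P3_2K2_free[of "co_adjacent R" V] by blast
next
  case False
  then have "clique_with_isolated_on V R"
    using free by (intro clique_with_isolated_on_if_P3_2K2_free sym irrefl)
      (auto simp: forbidden_quadruple_def)
  then show ?thesis ..
qed

end

section \<open>Seidel matrices and switching\<close>

abbreviation adjacent :: "'a pair_pre_digraph \<Rightarrow> 'a \<Rightarrow> 'a \<Rightarrow> bool" where
  "adjacent G \<equiv> \<lambda>x y. (x, y) \<in> parcs G"

lemma pair_graph_adjacent: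
  assumes "pair_graph G"
  shows "symp (adjacent G)" and "irreflp (adjacent G)"
    and "adjacent G x y \<Longrightarrow> x \<in> pverts G \<and> y \<in> pverts G" and "finite (pverts G)"
proof -
  interpret pair_graph G by fact
  show "symp (adjacent G)"
    using arcs_symmetric by (auto intro: sympI)
  show "irreflp (adjacent G)"
    using pair_no_loops by (force intro: irreflpI)
  show "adjacent G x y \<Longrightarrow> x \<in> pverts G \<and> y \<in> pverts G"
    using in_arcsD1 in_arcsD2 by blast
  show "finite (pverts G)"
    by (rule pair_finite_verts)
qed

lemma pair_graphI_adjacent:
  assumes "finite (pverts G)" and sym: "symp (adjacent G)" and "irreflp (adjacent G)"
    and wf: "\<And>x y. adjacent G x y \<Longrightarrow> x \<in> pverts G \<and> y \<in> pverts G"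
  shows "pair_graph G"
proof -
  have "parcs G \<subseteq> pverts G \<times> pverts G"
    using wf by auto
  then have "finite (parcs G)"
    using assms(1) finite_subset by blast
  moreover have "symmetric (with_proj G)"
    using sympD[OF sym] by (auto simp: symmetric_def intro!: symI)
  ultimately show ?thesis
    using assms(1) wf irreflpD[OF assms(3)] by unfold_locales auto
qed

lemma seidel_matrix_eq_seidel_entry:
  assumes "pair_graph G" and "distinct vs" and "i < length vs" and "j < length vs"
  shows "seidel_matrix G vs $$ (i, j) = seidel_entry (adjacent G) (vs ! i) (vs ! j)"
  using assms by (simp add: seidel_matrix_index seidel_entry_def nth_eq_iff_index_eq)

lemma seidel_matrix_carrier: "seidel_matrix G vs \<in> carrier_mat (length vs) (length vs)"
  unfolding seidel_matrix_def adjacency_matrix_def by (intro carrier_matI) simp_all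

lemma transpose_seidel_matrix:
  assumes "pair_graph G" and "distinct vs"
  shows "(seidel_matrix G vs)\<^sup>T = seidel_matrix G vs"
  using seidel_matrix_carrier[of G vs] sympD[OF pair_graph_adjacent(1)[OF assms(1)]] assms
  by (intro eq_matI) (auto simp: seidel_matrix_index)

lemma seidel_inner_self:
  assumes "finite T" and "x \<in> T"
  shows "seidel_inner R T x x = real (card T) - 1"
proof -
  have "seidel_inner R T x x = (\<Sum>t \<in> T - {x}. 1)"
    unfolding seidel_inner_def using assms
    by (intro sum.mono_neutral_cong_right) (auto simp: seidel_entry_def)
  also have "\<dots> = real (card T) - 1"
    using assms card_gt_0_iff[of T] by (auto simp: of_nat_diff)
  finally show ?thesis .
qed

definition positions :: "'a list \<Rightarrow> 'a set \<Rightarrow> nat set" where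
  "positions vs U = {i. i < length vs \<and> vs ! i \<in> U}"

lemma bij_betw_nth_positions:
  assumes "distinct vs" and "U \<subseteq> set vs"
  shows "bij_betw ((!) vs) (positions vs U) U"
proof (rule bij_betw_subset[OF bij_betw_nth[OF assms(1) refl refl]])
  show "(!) vs ` positions vs U = U"
    using assms(2) by (force simp: positions_def in_set_conv_nth)
qed (auto simp: positions_def)

lemma seidel_matrix_column_inner_product:
  assumes G: "pair_graph G" and vs: "distinct vs" and T: "T \<subseteq> set vs"
    and jk: "j < length vs" "k < length vs"
  shows "(\<Sum>t \<in> positions vs T. seidel_matrix G vs $$ (t, j) * seidel_matrix G vs $$ (t, k)) =
    seidel_inner (adjacent G) T (vs ! j) (vs ! k)"
proof -
  have "(\<Sum>t \<in> positions vs T. seidel_matrix G vs $$ (t, j) * seidel_matrix G vs $$ (t, k)) =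
      (\<Sum>t \<in> positions vs T.
        seidel_entry (adjacent G) (vs ! t) (vs ! j) * seidel_entry (adjacent G) (vs ! t) (vs ! k))"
    using G vs jk by (intro sum.cong) (auto simp: positions_def seidel_matrix_eq_seidel_entry)
  then show ?thesis
    using sum.reindex_bij_betw[OF bij_betw_nth_positions[OF vs T]] by (simp add: seidel_inner_def)
qed

lemma card_le_size_large_seidel_eigenvalues:
  assumes G: "pair_graph G" and vs: "distinct vs" "set vs = pverts G"
    and JT: "J \<subseteq> T" "T \<subseteq> pverts G" "card J + 1 < card T"
    and orthogonal: "nearly_orthogonal (adjacent G) T J"
  shows "card J \<le> size {#x \<in># eigenvalues_mset (seidel_matrix G vs). x \<notin> {-1..1}#}"
proof -
  let ?S = "seidel_matrix G vs" and ?J = "positions vs J" and ?T = "positions vs T"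
  note inner = seidel_matrix_column_inner_product[OF G vs(1) JT(2)[folded vs(2)]]
  have card_J: "card ?J = card J"
    using JT vs bij_betw_same_card[OF bij_betw_nth_positions] by blast
  have "card ?J \<le> size {#x \<in># eigenvalues_mset ?S. \<bar>x\<bar> > 1#}"
  proof (rule card_le_size_large_eigenvalues)
    show "?S \<in> carrier_mat (length vs) (length vs)" "?S\<^sup>T = ?S"
      using G vs(1) by (simp_all add: seidel_matrix_carrier transpose_seidel_matrix)
    show "?J \<subseteq> {..<length vs}" "?T \<subseteq> {..<length vs}"
      by (auto simp: positions_def)
  next
    fix j assume "j \<in> ?J"
    then have j: "j < length vs" "vs ! j \<in> J" "vs ! j \<in> T" "finite ?J"
      using JT(1) by (auto simp: positions_def)
    have "\<bar>\<Sum>t \<in> ?T. ?S $$ (t, j) * ?S $$ (t, k)\<bar> \<le> 1" if "k \<in> ?J - {j}" for k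
    proof -
      have k: "k < length vs" "vs ! k \<in> J" "vs ! j \<noteq> vs ! k"
        using j(1) that vs(1) by (auto simp: positions_def nth_eq_iff_index_eq)
      then show ?thesis
        using orthogonal j by (simp add: inner nearly_orthogonal_def pairwise_def)
    qed
    then have "(\<Sum>k \<in> ?J - {j}. \<bar>\<Sum>t \<in> ?T. ?S $$ (t, j) * ?S $$ (t, k)\<bar>) \<le> card (?J - {j})"
      using sum_bounded_above[of "?J - {j}" _ "1 :: real"] by simp
    also have "\<dots> < real (card T) - 1 - 1"
      using \<open>j \<in> ?J\<close> j(4) JT(3) card_gt_0_iff[of ?J] by (auto simp: card_J)
    also have "real (card T) - 1 = (\<Sum>t \<in> ?T. (?S $$ (t, j))\<^sup>2)"
      using inner[OF j(1,1)] seidel_inner_self[of T "vs ! j" "adjacent G"] j(3) JT(3)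
        card_ge_0_finite[of T] by (simp add: power2_eq_square)
    finally show "(\<Sum>k \<in> ?J - {j}. \<bar>\<Sum>t \<in> ?T. ?S $$ (t, j) * ?S $$ (t, k)\<bar>) + 1\<^sup>2
        < (\<Sum>t \<in> ?T. (?S $$ (t, j))\<^sup>2)"
      by simp
  qed
  moreover have "\<bar>x\<bar> > 1 \<longleftrightarrow> x \<notin> {-1..1}" for x :: real
    by auto
  ultimately show ?thesis
    by (simp only: card_J)
qed

lemma pverts_switch [simp]: "pverts (switch G X) = pverts G"
  by (simp add: switch_def)

lemma parcs_switch:
  "(u, v) \<in> parcs (switch G X) \<longleftrightarrow> u \<in> pverts G \<and> v \<in> pverts G \<and>
     ((u, v) \<in> parcs G \<longleftrightarrow> (u \<in> X \<longleftrightarrow> v \<in> X))"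
  by (auto simp: switch_def)

lemma pair_graph_switch:
  assumes "pair_graph G"
  shows "pair_graph (switch G X)"
proof (rule pair_graphI_adjacent)
  show "finite (pverts (switch G X))"
    using pair_graph_adjacent(4)[OF assms] by simp
  show "symp (adjacent (switch G X))"
    using sympD[OF pair_graph_adjacent(1)[OF assms]]
    by (intro sympI) (simp add: parcs_switch, blast)
  show "irreflp (adjacent (switch G X))"
    using irreflpD[OF pair_graph_adjacent(2)[OF assms]] by (intro irreflpI) (simp add: parcs_switch)
qed (simp add: parcs_switch)

lemma switch_switch: "switch (switch G X) Y = switch G (sym_diff X Y)"
  by (auto simp: switch_def)

lemma nearly_orthogonal_switch:
  assumes "J \<subseteq> T" and "T \<subseteq> pverts G"
  shows "nearly_orthogonal (adjacent (switch G X)) T J \<longleftrightarrow> nearly_orthogonal (adjacent G) T J"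
proof -
  define \<sigma> :: "'a \<Rightarrow> real" where "\<sigma> x = (if x \<in> X then -1 else 1)" for x
  have entry: "seidel_entry (adjacent (switch G X)) x y = \<sigma> x * \<sigma> y * seidel_entry (adjacent G) x y"
    if "x \<in> pverts G" "y \<in> pverts G" for x y
    using that by (simp add: seidel_entry_def parcs_switch \<sigma>_def)
  have "seidel_inner (adjacent (switch G X)) T x y = (\<sigma> x * \<sigma> y) * seidel_inner (adjacent G) T x y"
    if "x \<in> J" "y \<in> J" for x y
    unfolding seidel_inner_def sum_distrib_left
  proof (rule sum.cong)
    fix t assume "t \<in> T"
    have "\<sigma> t * \<sigma> t = 1"
      by (simp add: \<sigma>_def)
    moreover have "t \<in> pverts G" "x \<in> pverts G" "y \<in> pverts G"
      using assms that \<open>t \<in> T\<close> by auto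
    ultimately show "seidel_entry (adjacent (switch G X)) t x *
          seidel_entry (adjacent (switch G X)) t y =
        (\<sigma> x * \<sigma> y) * (seidel_entry (adjacent G) t x * seidel_entry (adjacent G) t y)"
      by (simp add: entry)
  qed simp
  then have "\<bar>seidel_inner (adjacent (switch G X)) T x y\<bar> = \<bar>seidel_inner (adjacent G) T x y\<bar>"
    if "x \<in> J" "y \<in> J" for x y
    using that by (simp add: abs_mult \<sigma>_def)
  then show ?thesis
    by (simp add: nearly_orthogonal_def pairwise_def)
qed

lemma no_forbidden_quadruple_in_switch:
  assumes G: "pair_graph G" and vs: "distinct vs" "set vs = pverts G"
    and few: "size {#x \<in># eigenvalues_mset (seidel_matrix G vs). x \<notin> {-1..1}#} \<le> 2"
    and v: "v \<in> pverts G" "\<And>x. \<not> adjacent (switch G X) v x"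
    and abcd: "{a, b, c, d} \<subseteq> pverts G - {v}"
  shows "\<not> forbidden_quadruple (adjacent (switch G X)) a b c d"
proof
  let ?T = "{a, b, c, d, v}"
  assume forbidden: "forbidden_quadruple (adjacent (switch G X)) a b c d"
  have "symp (adjacent (switch G X))"
    by (rule pair_graph_adjacent(1)[OF pair_graph_switch[OF G]])
  then obtain J where J: "J \<subseteq> ?T" "card J = 3" "nearly_orthogonal (adjacent (switch G X)) ?T J"
    using forbidden_quadruple_ex_nearly_orthogonal[OF _ v(2) _ forbidden] abcd by auto
  have T: "?T \<subseteq> pverts G"
    using v(1) abcd by simp
  have "card ?T = 5"
    using abcd forbidden_quadruple_distinct[OF forbidden] by auto
  then have "card J \<le> size {#x \<in># eigenvalues_mset (seidel_matrix G vs). x \<notin> {-1..1}#}"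
    using J nearly_orthogonal_switch[OF J(1) T, of X]
    by (intro card_le_size_large_seidel_eigenvalues[OF G vs J(1) T]) auto
  with few J(2) show False
    by simp
qed

section \<open>Switching into the family\<close>

lemma digraph_iso_with_projI:
  assumes "pair_wf_digraph G" and inj: "inj_on h (pverts G)"
    and "pverts H = h ` pverts G" and "parcs H = map_prod h h ` parcs G"
  shows "digraph_iso (with_proj G) (with_proj H)"
proof -
  interpret pair_wf_digraph G by fact
  let ?iso = "\<lparr>iso_verts = h, iso_arcs = map_prod h h, iso_head = snd, iso_tail = fst\<rparr>"
  have "parcs G \<subseteq> pverts G \<times> pverts G"
    using in_arcsD1 in_arcsD2 by auto
  then have "inj_on (map_prod h h) (parcs G)"
    using map_prod_inj_on[OF inj inj] inj_on_subset by blast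
  then have "pre_digraph.digraph_isomorphism (with_proj G) ?iso"
    using inj wf_digraph_axioms by (simp add: pre_digraph.digraph_isomorphism_def)
  moreover have "with_proj H = app_iso ?iso (with_proj G)"
    using assms(3,4) by (simp add: with_proj_def app_iso_def)
  ultimately show ?thesis
    unfolding digraph_iso_def by blast
qed

lemma switching_equivalent_switch:
  assumes "pair_graph G" and "X \<subseteq> pverts G"
  shows "switching_equivalent G (switch G X)"
proof -
  interpret pair_graph "switch G X"
    using assms(1) by (rule pair_graph_switch)
  have "digraph_iso (with_proj (switch G X)) (with_proj (switch G X))"
    by (rule digraph_iso_with_projI[of _ id]) (auto simp: prod.map_id0)
  then show ?thesis
    using assms(2) unfolding switching_equivalent_def by blast
qed

lemma ex_bij_betw_initial_segments:
  assumes "finite V" and "K \<subseteq> V"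
  shows "\<exists>h. bij_betw h V {..<card V} \<and> h ` K = {..<card K}"
proof -
  obtain f where f: "bij_betw f K {..<card K}"
    using finite_same_card_bij[of K "{..<card K}"] finite_subset assms by auto
  have "card (V - K) = card {card K..<card V}"
    using assms by (simp add: card_Diff_subset finite_subset)
  then obtain g where g: "bij_betw g (V - K) {card K..<card V}"
    using finite_same_card_bij[of "V - K" "{card K..<card V}"] assms(1) by auto
  let ?h = "\<lambda>x. if x \<in> K then f x else g x"
  have "bij_betw ?h (K \<union> (V - K)) ({..<card K} \<union> {card K..<card V})"
    using f g by (intro bij_betw_disjoint_Un) auto
  moreover have "K \<union> (V - K) = V" "{..<card K} \<union> {card K..<card V} = {..<card V}"
    using assms card_mono[OF assms] by auto
  moreover have "?h ` K = {..<card K}"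
    using f by (simp add: bij_betw_def)
  ultimately show ?thesis
    by (intro exI[of _ ?h] conjI) simp_all
qed

lemma clique_with_isolated_on_ex_iso:
  assumes H: "pair_graph H" and "pverts H \<noteq> {}"
    and "clique_with_isolated_on (pverts H) (adjacent H)"
  shows "\<exists>m l. m \<ge> 1 \<and> digraph_iso (with_proj H) (with_proj (clique_plus_isolated m l))"
proof -
  interpret pair_graph H by fact
  obtain v K\<^sub>0 where v: "v \<in> pverts H" and K\<^sub>0: "K\<^sub>0 \<subseteq> pverts H"
    "\<And>x y. x \<in> pverts H \<Longrightarrow> y \<in> pverts H \<Longrightarrow> adjacent H x y \<longleftrightarrow> x \<noteq> y \<and> x \<in> K\<^sub>0 \<and> y \<in> K\<^sub>0"
    using assms(2,3) unfolding clique_with_isolated_on_def by blast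
  \<comment> \<open>An edgeless graph is \<open>K\<^sub>1\<close> plus isolated vertices.\<close>
  define K where "K = (if K\<^sub>0 = {} then {v} else K\<^sub>0)"
  have K: "K \<subseteq> pverts H" "K \<noteq> {}"
    using v K\<^sub>0(1) by (auto simp: K_def)
  have "adjacent H x y \<longleftrightarrow> x \<noteq> y \<and> x \<in> K \<and> y \<in> K" for x y
    using v K\<^sub>0(1) K\<^sub>0(2)[of x y] pair_graph_adjacent(3)[OF H, of x y] by (auto simp: K_def)
  then have arcs: "parcs H = {(x, y). x \<noteq> y \<and> x \<in> K \<and> y \<in> K}"
    by auto
  obtain h where h: "bij_betw h (pverts H) {..<card (pverts H)}" "h ` K = {..<card K}"
    using ex_bij_betw_initial_segments[OF pair_finite_verts K(1)] by blast
  have inj: "inj_on h (pverts H)" "inj_on h K"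
    using h(1) K(1) by (auto simp: bij_betw_def intro: inj_on_subset)
  have "map_prod h h ` parcs H = {(u, v). u \<in> h ` K \<and> v \<in> h ` K \<and> u \<noteq> v}"
    using inj(2) by (force simp: arcs inj_on_def)
  then have "digraph_iso (with_proj H)
      (with_proj (clique_plus_isolated (card K) (card (pverts H) - card K)))"
    using inj(1) h card_mono[OF pair_finite_verts K(1)]
    by (intro digraph_iso_with_projI[of _ h]) (auto simp: clique_plus_isolated_def bij_betw_def)
  moreover have "card K \<ge> 1"
    using K pair_finite_verts by (simp add: Suc_le_eq card_gt_0_iff finite_subset)
  ultimately show ?thesis
    by blast
qed

lemma clique_with_isolated_on_cong:
  assumes "\<And>x y. x \<in> V \<Longrightarrow> y \<in> V \<Longrightarrow> R x y \<longleftrightarrow> R' x y"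
  shows "clique_with_isolated_on V R \<longleftrightarrow> clique_with_isolated_on V R'"
  using assms by (simp add: clique_with_isolated_on_def)

lemma clique_with_isolated_on_insert:
  assumes "clique_with_isolated_on (V - {v}) R" and "\<And>x. x \<in> V \<Longrightarrow> \<not> R v x \<and> \<not> R x v"
  shows "clique_with_isolated_on V R"
proof -
  obtain K where K: "K \<subseteq> V - {v}"
    and clique: "\<forall>x \<in> V - {v}. \<forall>y \<in> V - {v}. R x y \<longleftrightarrow> x \<noteq> y \<and> x \<in> K \<and> y \<in> K"
    using assms(1) unfolding clique_with_isolated_on_def by blast
  have "R x y \<longleftrightarrow> x \<noteq> y \<and> x \<in> K \<and> y \<in> K" if "x \<in> V" "y \<in> V" for x y
    using that K clique assms(2)[of x] assms(2)[of y] by (cases "x = v \<or> y = v") auto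
  then show ?thesis
    using K unfolding clique_with_isolated_on_def by (intro exI[of _ K]) blast
qed

lemma family_F_if_isolated:
  assumes H: "pair_graph H" and v: "v \<in> pverts H" "\<And>x. \<not> adjacent H v x"
    and clique: "clique_with_isolated_on (pverts H - {v}) (adjacent H)"
  shows "H \<in> family_F"
proof -
  have "\<not> adjacent H x v" for x
    using v(2) sympD[OF pair_graph_adjacent(1)[OF H]] by blast
  then have "clique_with_isolated_on (pverts H) (adjacent H)"
    using clique_with_isolated_on_insert[OF clique] v(2) by simp
  then show ?thesis
    unfolding family_F_def using clique_with_isolated_on_ex_iso[OF H] H v(1) by blast
qed

lemma pair_graph_complement:
  assumes "pair_graph G"
  shows "pair_graph (graph_complement G)"
proof (rule pair_graphI_adjacent)
  show "finite (pverts (graph_complement G))"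
    using pair_graph_adjacent(4)[OF assms] by (simp add: graph_complement_def)
  show "symp (adjacent (graph_complement G))"
    using sympD[OF pair_graph_adjacent(1)[OF assms]]
    by (intro sympI) (simp add: graph_complement_def, blast)
qed (simp_all add: graph_complement_def irreflpI)

lemma switch_isolated_in_family_F:
  assumes H: "pair_graph H" and v: "v \<in> pverts H" "\<And>x. \<not> adjacent H v x"
    and co_clique: "clique_with_isolated_on (pverts H - {v}) (co_adjacent (adjacent H))"
  shows "switch H {v} \<in> family_F"
proof -
  let ?C = "graph_complement (switch H {v})"
  have C: "pair_graph ?C" "pverts ?C = pverts H"
    using pair_graph_complement[OF pair_graph_switch[OF H]] by (auto simp: graph_complement_def)
  have not_v: "\<not> adjacent H x v" for x
    using v(2) sympD[OF pair_graph_adjacent(1)[OF H]] by blast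
  have "clique_with_isolated_on (pverts H - {v}) (adjacent ?C)"
    using co_clique
    by (rule iffD1[OF clique_with_isolated_on_cong, rotated])
      (auto simp: graph_complement_def parcs_switch co_adjacent_def)
  then have "clique_with_isolated_on (pverts H) (adjacent ?C)"
    using v not_v
    by (elim clique_with_isolated_on_insert) (auto simp: graph_complement_def parcs_switch)
  then have "\<exists>m l. m \<ge> 1 \<and> digraph_iso (with_proj ?C) (with_proj (clique_plus_isolated m l))"
    using C v(1) by (intro clique_with_isolated_on_ex_iso) auto
  then show ?thesis
    unfolding family_F_def using pair_graph_switch[OF H] by blast
qed

theorem theorem3p2:
  fixes G :: "'a pair_pre_digraph" and vs :: "'a list"
  assumes "pair_graph G"
    and "pverts G \<noteq> {}"
    and "distinct vs" and "set vs = pverts G"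
    and "size {#x \<in># eigenvalues_mset (seidel_matrix G vs). x \<notin> {-1..1}#} \<le> 2"
  shows "\<exists>H :: 'a pair_pre_digraph. H \<in> family_F \<and> switching_equivalent G H"
proof -
  obtain v where v: "v \<in> pverts G"
    using assms(2) by blast
  define X where "X = {x. adjacent G v x}"
  let ?H = "switch G X"
  have X: "X \<subseteq> pverts G" "v \<notin> X"
    using pair_graph_adjacent(3)[OF assms(1)] irreflpD[OF pair_graph_adjacent(2)[OF assms(1)], of v]
    by (auto simp: X_def)
  then have isolated: "\<not> adjacent ?H v x" for x
    by (auto simp: parcs_switch X_def)
  have H: "pair_graph ?H"
    using assms(1) by (rule pair_graph_switch)
  have "clique_with_isolated_on (pverts ?H - {v}) (adjacent ?H) \<or>
      clique_with_isolated_on (pverts ?H - {v}) (co_adjacent (adjacent ?H))"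
    using pair_graph_adjacent(1,2)[OF H]
      no_forbidden_quadruple_in_switch[OF assms(1,3,4,5) v isolated]
    by (intro clique_with_isolated_or_complement) simp_all
  then have "?H \<in> family_F \<or> switch ?H {v} \<in> family_F"
    using family_F_if_isolated[OF H _ isolated] switch_isolated_in_family_F[OF H _ isolated] v
    by auto
  moreover have "switching_equivalent G ?H" "switching_equivalent G (switch ?H {v})"
    using X(1) v unfolding switch_switch by (auto intro!: switching_equivalent_switch[OF assms(1)])
  ultimately show ?thesis
    by blast
qed

end
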